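(* Let $G$ be a finitely generated group of subexponential growth and let $X$ be a Suslinian continuum. Then $G$ cannot act on $X$ expansively; that is, there is no expansive continuous action of $G$ on $X$.
   Context: A continuum is a nonempty compact connected metric space; it is nondegenerate if it is not a single point. A subcontinuum of $X$ is a subset of $X$ that is itself a continuum. A continuum $X$ is called Suslinian if it does not contain uncountably many mutually disjoint nondegenerate subcontinua. Groups are regarded as discrete groups. A continuous action of a discrete group $G$ on a compact metric space $X$ is a group homomorphism $\phi: G\to \mathrm{Homeo}(X)$, where $\mathrm{Homeo}(X)$ is the group of homeomorphisms of $X$; one writes $gx$ for $\phi(g)(x)$. The action on $(X,d)$ is expansive if there is $c>0$ such that $\sup_{g\in G} d(gx,gy)>c$ for all distinct $x,y\in X$. For a finitely generated group $H$ with finite generating set $S$, let $|h|$ denote the word length of $h\in H$ with respect to $S$, and let $\beta(H,S;k)=\#\{h\in H: |h|\le k\}$ for $k\in\mathbb{N}$. The group $H$ is of subexponential growth if $\lim_{k\to\infty}\sqrt[k]{\beta(H,S;k)}\le 1$.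
   Formalization: The continuum X is assumed nondegenerate (not a single point); on a one-point continuum, which is Suslinian, the trivial action of any group is vacuously expansive, so the claim fails there. *)

theory Defs
  imports "HOL-Analysis.Analysis" "HOL-Algebra.Bij" "HOL-Algebra.Generated_Groups"
begin

text \<open>A compact metric space is represented by a compact subset of a type of class
  \<^class>\<open>metric_space\<close>, with the metric \<^const>\<open>dist\<close>.\<close>

definition continuum :: "'a::metric_space set \<Rightarrow> bool"
  where "continuum X \<longleftrightarrow> X \<noteq> {} \<and> compact X \<and> connected X"

definition nondegenerate :: "'a set \<Rightarrow> bool"
  where "nondegenerate X \<longleftrightarrow> (\<nexists>x. X = {x})"

definition subcontinuum :: "'a::metric_space set \<Rightarrow> 'a set \<Rightarrow> bool"
  where "subcontinuum C X \<longleftrightarrow> C \<subseteq> X \<and> continuum C"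

definition suslinian_continuum :: "'a::metric_space set \<Rightarrow> bool"
  where "suslinian_continuum X \<longleftrightarrow> continuum X \<and>
    \<not> (\<exists>\<C>. uncountable \<C> \<and> pairwise disjnt \<C> \<and>
          (\<forall>C\<in>\<C>. subcontinuum C X \<and> nondegenerate C))"

text \<open>As for \<^const>\<open>BijGroup\<close>, the elements of the homeomorphism group are extensional functions.\<close>

definition Homeo :: "'a::topological_space set \<Rightarrow> ('a \<Rightarrow> 'a) set"
  where "Homeo X = {f \<in> Bij X. \<exists>g. homeomorphism X X f g}"

definition HomeoGroup :: "'a::topological_space set \<Rightarrow> ('a \<Rightarrow> 'a) monoid"
  where "HomeoGroup X = BijGroup X \<lparr>carrier := Homeo X\<rparr>"

lemma subgroup_Homeo: "subgroup (Homeo X) (BijGroup X)"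
proof (rule group.subgroupI[OF group_BijGroup])
  show "Homeo X \<subseteq> carrier (BijGroup X)"
    by (auto simp: Homeo_def BijGroup_def)
  have "homeomorphism X X (\<lambda>x\<in>X. x) (\<lambda>x. x)"
    by (auto simp: homeomorphism_def cong: continuous_on_cong)
  then show "Homeo X \<noteq> {}"
    using id_Bij[of X] by (auto simp: Homeo_def)
next
  fix f assume f: "f \<in> Homeo X"
  then obtain g where fB: "f \<in> Bij X" and g: "homeomorphism X X f g"
    by (auto simp: Homeo_def)
  have bij: "bij_betw f X X"
    using fB by (simp add: Bij_def)
  have eq: "inv\<^bsub>BijGroup X\<^esub> f = (\<lambda>x\<in>X. inv_into X f x)"
    using fB by (rule inv_BijGroup)
  have "(\<lambda>x\<in>X. inv_into X f x) x = g x" if "x \<in> X" for x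
    using that bij g
    by (auto simp: homeomorphism_def bij_betw_def intro!: inv_into_f_eq)
  then have "homeomorphism X X (\<lambda>x\<in>X. inv_into X f x) f"
    using g homeomorphism_cong[OF homeomorphism_symD[OF g]] by metis
  then show "inv\<^bsub>BijGroup X\<^esub> f \<in> Homeo X"
    unfolding eq Homeo_def using restrict_inv_into_Bij[OF fB] by blast
next
  fix f f' assume "f \<in> Homeo X" "f' \<in> Homeo X"
  then obtain g g' where B: "f \<in> Bij X" "f' \<in> Bij X"
    and h: "homeomorphism X X f g" "homeomorphism X X f' g'"
    by (auto simp: Homeo_def)
  have "homeomorphism X X (f \<circ> f') (g' \<circ> g)"
    using homeomorphism_compose[OF h(2,1)] .
  then have "homeomorphism X X (compose X f f') (g' \<circ> g)"
    by (rule homeomorphism_cong) (auto simp: compose_def)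
  then show "f \<otimes>\<^bsub>BijGroup X\<^esub> f' \<in> Homeo X"
    using B compose_Bij[OF B] by (auto simp: Homeo_def BijGroup_def)
qed

lemma group_HomeoGroup: "group (HomeoGroup X)"
  unfolding HomeoGroup_def
  by (rule subgroup.subgroup_is_group[OF subgroup_Homeo group_BijGroup])

definition continuous_group_action ::
    "('g, 'm) monoid_scheme \<Rightarrow> 'a::topological_space set \<Rightarrow> ('g \<Rightarrow> 'a \<Rightarrow> 'a) \<Rightarrow> bool"
  where "continuous_group_action G X \<phi> \<longleftrightarrow> \<phi> \<in> hom G (HomeoGroup X)"

text \<open>The conditionally complete supremum is the intended one, since a compact \<open>X\<close> is bounded.\<close>

definition expansive ::
    "('g, 'm) monoid_scheme \<Rightarrow> 'a::metric_space set \<Rightarrow> ('g \<Rightarrow> 'a \<Rightarrow> 'a) \<Rightarrow> bool"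
  where "expansive G X \<phi> \<longleftrightarrow>
    (\<exists>c>0. \<forall>x\<in>X. \<forall>y\<in>X. x \<noteq> y \<longrightarrow> (SUP g\<in>carrier G. dist (\<phi> g x) (\<phi> g y)) > c)"

definition finite_generating_set :: "('g, 'm) monoid_scheme \<Rightarrow> 'g set \<Rightarrow> bool"
  where "finite_generating_set G S \<longleftrightarrow>
    finite S \<and> S \<subseteq> carrier G \<and> generate G S = carrier G"

definition word_length :: "('g, 'm) monoid_scheme \<Rightarrow> 'g set \<Rightarrow> 'g \<Rightarrow> nat"
  where "word_length G S h =
    (LEAST n. \<exists>ws. set ws \<subseteq> S \<union> m_inv G ` S \<and> length ws = n \<and>
       foldr (mult G) ws \<one>\<^bsub>G\<^esub> = h)"

definition growth :: "('g, 'm) monoid_scheme \<Rightarrow> 'g set \<Rightarrow> nat \<Rightarrow> nat"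
  where "growth G S k = card {h \<in> carrier G. word_length G S h \<le> k}"

text \<open>The limit always exists, by submultiplicativity of the growth function, and whether it
  is at most 1 does not depend on the choice of the finite generating set.\<close>

definition subexponential_growth :: "('g, 'm) monoid_scheme \<Rightarrow> 'g set \<Rightarrow> bool"
  where "subexponential_growth G S \<longleftrightarrow>
    (\<exists>L\<le>1. (\<lambda>k. root k (real (growth G S k))) \<longlonglongrightarrow> L)"

end

theory Submission
  imports Defs
begin

text \<open>Suppose \<open>G\<close> acts expansively with constant \<open>c\<close>. A subcontinuum of diameter at least \<open>c\<close>
  contains two disjoint subcontinua of diameter at least \<open>c/4\<close> (boundary bumping), and by
  compactness each of them is expanded to diameter at least \<open>c\<close> by an element of a fixed finite
  subset of \<open>G\<close>. Iterating \<open>k\<close> times gives \<open>2^k\<close> disjoint pieces and group elements of length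
  \<open>O(k)\<close>; by subexponential growth arbitrarily many pieces share the same element, whose images are
  arbitrarily many disjoint subcontinua of diameter at least \<open>c\<close>. This is not yet a contradiction,
  since a Suslinian continuum may contain infinitely many of those. So the argument is run inside a
  minimal family of ``large'' compact sets on which the splitting procedure still works: a
  Cantor-Bendixson derivative of the family admits the procedure too, hence by minimality it is
  either the whole family, and then a Cantor scheme yields uncountably many disjoint continua, or it
  no longer contains \<open>X\<close>, and then the number of disjoint members is bounded.\<close>

section \<open>Branching families and their derivatives\<close>

text \<open>Closure under decreasing limits, phrased with neighbourhoods so that no Hausdorff metric on
  the hyperspace of compact sets is needed.\<close>

definition outer_regular :: "'a::topological_space set \<Rightarrow> 'a set set \<Rightarrow> bool"
  where "outer_regular X \<L> \<longleftrightarrow> \<L> \<subseteq> {U. compact U \<and> U \<subseteq> X \<and> U \<noteq> {}} \<and>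
    (\<forall>U. compact U \<longrightarrow> U \<subseteq> X \<longrightarrow> (\<forall>V. open V \<longrightarrow> U \<subseteq> V \<longrightarrow> (\<exists>W\<in>\<L>. W \<subseteq> V)) \<longrightarrow> U \<in> \<L>)"

text \<open>The index \<open>i\<close> records how a set is split in two and which group elements expand the halves.
  It ranges over a fixed finite set so that the pigeonhole principle applies to it.\<close>

definition branching :: "('i \<Rightarrow> bool \<Rightarrow> 'a set \<Rightarrow> 'a set) \<Rightarrow> 'i set \<Rightarrow> 'a set set \<Rightarrow> bool"
  where "branching f I \<L> \<longleftrightarrow> (\<forall>U\<in>\<L>. \<exists>i\<in>I. \<forall>b. f i b U \<in> \<L>)"

text \<open>A Cantor-Bendixson derivative in which accumulation at \<open>U\<close> means room for
  arbitrarily large finite disjoint subfamilies in every neighbourhood. Finite sizes are what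
  pigeonhole arguments deliver.\<close>

definition derived_family :: "'a::topological_space set \<Rightarrow> 'a set set \<Rightarrow> 'a set set"
  where "derived_family X \<L> = {U. compact U \<and> U \<subseteq> X \<and>
    (\<forall>V n. open V \<longrightarrow> U \<subseteq> V \<longrightarrow>
      (\<exists>\<W>\<subseteq>\<L>. finite \<W> \<and> card \<W> = n \<and> pairwise disjnt \<W> \<and> \<Union>\<W> \<subseteq> V))}"

lemma outer_regularD:
  assumes "outer_regular X \<L>" "U \<in> \<L>"
  shows "compact U" "U \<subseteq> X" "U \<noteq> {}"
  using assms unfolding outer_regular_def by blast+

lemma outer_regularI:
  assumes "outer_regular X \<L>" "compact U" "U \<subseteq> X"
    and "\<And>V. open V \<Longrightarrow> U \<subseteq> V \<Longrightarrow> \<exists>W\<in>\<L>. W \<subseteq> V"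
  shows "U \<in> \<L>"
  using assms unfolding outer_regular_def by blast

section \<open>Existence of a minimal branching family\<close>

text \<open>Serves to gather finitely many failures along a chain, one per index, at a single
  member.\<close>

lemma chain_lower_bound:
  assumes "finite I" "\<D> \<noteq> {}" "\<And>i. i \<in> I \<Longrightarrow> D i \<in> \<D>"
    and chain: "\<And>A B. A \<in> \<D> \<Longrightarrow> B \<in> \<D> \<Longrightarrow> A \<subseteq> B \<or> B \<subseteq> A"
  shows "\<exists>B\<in>\<D>. \<forall>i\<in>I. B \<subseteq> D i"
  using assms(1,3)
proof (induction I)
  case empty
  then show ?case using assms(2) by auto
next
  case (insert i I)
  then obtain B where B: "B \<in> \<D>" "\<forall>i\<in>I. B \<subseteq> D i" by auto
  have "D i \<in> \<D>" using insert by auto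
  then consider "B \<subseteq> D i" | "D i \<subseteq> B" using chain B(1) by blast
  then show ?case
  proof cases
    case 1 then show ?thesis using B by auto
  next
    case 2 then show ?thesis using B \<open>D i \<in> \<D>\<close> by (intro bexI[of _ "D i"]) auto
  qed
qed

text \<open>Zorn's lemma for reversed inclusion: outer regularity passes to all nonempty
  intersections, and branching passes to intersections of chains because \<open>I\<close> is
  finite.\<close>

lemma minimal_branching_family:
  assumes "outer_regular X \<L>\<^sub>0" "branching f I \<L>\<^sub>0" "X \<in> \<L>\<^sub>0" "finite I"
  obtains \<L> where "outer_regular X \<L>" "branching f I \<L>" "X \<in> \<L>" "\<L> \<subseteq> \<L>\<^sub>0"
    "\<forall>\<K>. outer_regular X \<K> \<longrightarrow> branching f I \<K> \<longrightarrow> X \<in> \<K> \<longrightarrow> \<K> \<subseteq> \<L> \<longrightarrow> \<K> = \<L>"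
proof -
  define good where "good = {\<L>. outer_regular X \<L> \<and> branching f I \<L> \<and> X \<in> \<L> \<and> \<L> \<subseteq> \<L>\<^sub>0}"
  have inter: "\<Inter>\<D> \<in> good"
    if ne: "\<D> \<noteq> {}" and sub: "\<D> \<subseteq> good"
      and chain: "\<And>A B. A \<in> \<D> \<Longrightarrow> B \<in> \<D> \<Longrightarrow> A \<subseteq> B \<or> B \<subseteq> A" for \<D>
  proof -
    obtain D where D: "D \<in> \<D>" using ne by auto
    have "outer_regular X (\<Inter>\<D>)"
      unfolding outer_regular_def
    proof (intro conjI allI impI)
      have "D \<subseteq> {U. compact U \<and> U \<subseteq> X \<and> U \<noteq> {}}"
        using subsetD[OF sub D] unfolding good_def outer_regular_def by blast
      then show "\<Inter>\<D> \<subseteq> {U. compact U \<and> U \<subseteq> X \<and> U \<noteq> {}}"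
        using D by blast
    next
      fix U assume U: "compact U" "U \<subseteq> X" "\<forall>V. open V \<longrightarrow> U \<subseteq> V \<longrightarrow> (\<exists>W\<in>\<Inter>\<D>. W \<subseteq> V)"
      show "U \<in> \<Inter>\<D>"
      proof
        fix \<K> assume "\<K> \<in> \<D>"
        then have "outer_regular X \<K>" using sub by (auto simp: good_def)
        then show "U \<in> \<K>"
          using U \<open>\<K> \<in> \<D>\<close> by (elim outer_regularI) blast+
      qed
    qed
    moreover have "branching f I (\<Inter>\<D>)"
      unfolding branching_def
    proof (rule ballI, rule ccontr)
      fix U assume U: "U \<in> \<Inter>\<D>" and neg: "\<not> (\<exists>i\<in>I. \<forall>b. f i b U \<in> \<Inter>\<D>)"
      \<comment> \<open>Each index fails at some member \<open>B i\<close> of the chain. A member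
        \<open>E\<close> below all of them has a working index, which then works for its own
        \<open>B i\<close> too.\<close>
      then have "\<forall>i. \<exists>B. i \<in> I \<longrightarrow> B \<in> \<D> \<and> (\<exists>b. f i b U \<notin> B)" by blast
      then obtain B where B: "\<And>i. i \<in> I \<Longrightarrow> B i \<in> \<D> \<and> (\<exists>b. f i b U \<notin> B i)" by metis
      obtain E where E: "E \<in> \<D>" "\<forall>i\<in>I. E \<subseteq> B i"
        using chain_lower_bound[of I \<D> B] assms(4) ne B chain by blast
      then obtain i where "i \<in> I" "\<forall>b. f i b U \<in> E"
        using subsetD[OF sub E(1)] U unfolding good_def branching_def by blast
      then show False using B E by blast
    qed
    ultimately show ?thesis
      using D sub by (auto simp: good_def)
  qed
  \<comment> \<open>Passing to complements turns minimal families into maximal sets.\<close>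
  have "\<exists>M\<in>uminus ` good. \<forall>\<K>\<in>uminus ` good. M \<subseteq> \<K> \<longrightarrow> \<K> = M"
  proof (rule subset_Zorn_nonempty)
    show "uminus ` good \<noteq> {}" using assms by (auto simp: good_def)
  next
    fix \<C> assume C: "\<C> \<noteq> {}" "subset.chain (uminus ` good) \<C>"
    have "\<Inter>(uminus ` \<C>) \<in> good"
      using C by (intro inter) (auto simp: subset_chain_def)
    moreover have "\<Union>\<C> = - \<Inter>(uminus ` \<C>)" by auto
    ultimately show "\<Union>\<C> \<in> uminus ` good" by blast
  qed
  then obtain \<L> where L: "\<L> \<in> good" and min: "\<And>\<K>. \<K> \<in> good \<Longrightarrow> \<K> \<subseteq> \<L> \<Longrightarrow> \<K> = \<L>"
    by (auto simp: image_iff)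
  show ?thesis
  proof (rule that[of \<L>])
    show "\<forall>\<K>. outer_regular X \<K> \<longrightarrow> branching f I \<K> \<longrightarrow> X \<in> \<K> \<longrightarrow> \<K> \<subseteq> \<L> \<longrightarrow> \<K> = \<L>"
      using L min by (auto simp: good_def)
  qed (use L in \<open>auto simp: good_def\<close>)
qed

section \<open>The derivative of a family\<close>

lemma derived_familyE:
  assumes "U \<in> derived_family X \<L>" "open V" "U \<subseteq> V"
  obtains \<W> where "\<W> \<subseteq> \<L>" "finite \<W>" "card \<W> = n" "pairwise disjnt \<W>" "\<Union>\<W> \<subseteq> V"
proof -
  have "\<forall>V n. open V \<longrightarrow> U \<subseteq> V \<longrightarrow>
      (\<exists>\<W>\<subseteq>\<L>. finite \<W> \<and> card \<W> = n \<and> pairwise disjnt \<W> \<and> \<Union>\<W> \<subseteq> V)"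
    using assms(1) by (simp add: derived_family_def)
  from this[rule_format, OF assms(2,3), of n] show ?thesis using that by auto
qed

text \<open>Disjoint subfamilies of size one already give the hypothesis of outer
  regularity.\<close>

lemma derived_family_subset:
  assumes "outer_regular X \<L>"
  shows "derived_family X \<L> \<subseteq> \<L>"
proof
  fix U assume U: "U \<in> derived_family X \<L>"
  show "U \<in> \<L>"
  proof (rule outer_regularI[OF assms])
    fix V assume "open V" "U \<subseteq> V"
    with U obtain \<W> where "\<W> \<subseteq> \<L>" "card \<W> = 1" "\<Union>\<W> \<subseteq> V"
      by (rule derived_familyE)
    then show "\<exists>W\<in>\<L>. W \<subseteq> V" by (auto simp: card_1_singleton_iff)
  qed (use U in \<open>auto simp: derived_family_def\<close>)
qed

text \<open>A neighbourhood of \<open>U\<close> contains some member \<open>W\<close> of the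
  derivative, hence is a neighbourhood of \<open>W\<close> as well.\<close>

lemma outer_regular_derived_family:
  assumes "outer_regular X \<L>"
  shows "outer_regular X (derived_family X \<L>)"
  unfolding outer_regular_def
proof (intro conjI allI impI)
  show "derived_family X \<L> \<subseteq> {U. compact U \<and> U \<subseteq> X \<and> U \<noteq> {}}"
    using derived_family_subset[OF assms] assms by (auto simp: outer_regular_def)
next
  fix U assume U: "compact U" "U \<subseteq> X" "\<forall>V. open V \<longrightarrow> U \<subseteq> V \<longrightarrow> (\<exists>W\<in>derived_family X \<L>. W \<subseteq> V)"
  show "U \<in> derived_family X \<L>"
    unfolding derived_family_def mem_Collect_eq
  proof (intro conjI allI impI)
    fix V n assume V: "open V" "U \<subseteq> V"
    then obtain W where W: "W \<in> derived_family X \<L>" "W \<subseteq> V" using U by blast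
    show "\<exists>\<W>\<subseteq>\<L>. finite \<W> \<and> card \<W> = n \<and> pairwise disjnt \<W> \<and> \<Union>\<W> \<subseteq> V"
      by (rule derived_familyE[OF W(1) V(1) W(2), of n]) blast
  qed (use U in auto)
qed

text \<open>Among many disjoint members near \<open>U\<close>, many split with the same index, and that index then
  also splits \<open>U\<close> for the derivative.\<close>

lemma branching_derived_family:
  assumes L: "outer_regular X \<L>" "branching f I \<L>" and "finite I"
    and disj: "\<And>i b A B. i \<in> I \<Longrightarrow> A \<subseteq> X \<Longrightarrow> B \<subseteq> X \<Longrightarrow> disjnt A B \<Longrightarrow> disjnt (f i b A) (f i b B)"
    and comp: "\<And>i b U. i \<in> I \<Longrightarrow> compact U \<Longrightarrow> U \<subseteq> X \<Longrightarrow> compact (f i b U) \<and> f i b U \<subseteq> X"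
    and cont: "\<And>i b U V. i \<in> I \<Longrightarrow> compact U \<Longrightarrow> U \<subseteq> X \<Longrightarrow> open V \<Longrightarrow> f i b U \<subseteq> V \<Longrightarrow>
      \<exists>V'. open V' \<and> U \<subseteq> V' \<and> (\<forall>W\<subseteq>X. W \<subseteq> V' \<longrightarrow> f i b W \<subseteq> V)"
  shows "branching f I (derived_family X \<L>)"
  unfolding branching_def
proof (rule ballI, rule ccontr)
  fix U assume U: "U \<in> derived_family X \<L>" and neg: "\<not> (\<exists>i\<in>I. \<forall>b. f i b U \<in> derived_family X \<L>)"
  have U': "compact U" "U \<subseteq> X" using U by (auto simp: derived_family_def)
  define full where "full V n \<longleftrightarrow> (\<exists>\<W>\<subseteq>\<L>. finite \<W> \<and> card \<W> = n \<and> pairwise disjnt \<W> \<and> \<Union>\<W> \<subseteq> V)"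
    for V n
  \<comment> \<open>For a failing index, one of the two halves of \<open>U\<close> has a
    neighbourhood \<open>V\<close> without room for \<open>n\<close> disjoint members;
    \<open>cont\<close> pulls \<open>V\<close> back to a neighbourhood \<open>V'\<close> of
    \<open>U\<close>.\<close>
  have "\<exists>b V V' n. open V' \<and> U \<subseteq> V' \<and> (\<forall>W\<subseteq>X. W \<subseteq> V' \<longrightarrow> f i b W \<subseteq> V) \<and> \<not> full V n" if i: "i \<in> I" for i
  proof -
    obtain b where b: "f i b U \<notin> derived_family X \<L>" using neg i by auto
    then obtain V n where V: "open V" "f i b U \<subseteq> V" and no: "\<not> full V n"
      using comp[OF i U', of b] by (auto simp: derived_family_def full_def)
    obtain V' where "open V'" "U \<subseteq> V'" "\<forall>W\<subseteq>X. W \<subseteq> V' \<longrightarrow> f i b W \<subseteq> V"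
      using cont[OF i U' V] by auto
    with no show ?thesis by blast
  qed
  then obtain b V V' n where V: "\<And>i. i \<in> I \<Longrightarrow> open (V' i) \<and> U \<subseteq> V' i \<and> (\<forall>W\<subseteq>X. W \<subseteq> V' i \<longrightarrow> f i (b i) W \<subseteq> V i)"
    and none: "\<And>i. i \<in> I \<Longrightarrow> \<not> full (V i) (n i)"
    by metis
  have "open (\<Inter>i\<in>I. V' i)" "U \<subseteq> (\<Inter>i\<in>I. V' i)"
    using V \<open>finite I\<close> by auto
  \<comment> \<open>One more than the sum of all bounds \<open>n i\<close>, so that some index must
    serve more than \<open>n i\<close> members.\<close>
  with U obtain \<W> where W: "\<W> \<subseteq> \<L>" "finite \<W>" "card \<W> = Suc (\<Sum>i\<in>I. n i)" "pairwise disjnt \<W>"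
    "\<Union>\<W> \<subseteq> (\<Inter>i\<in>I. V' i)"
    by (rule derived_familyE)
  have "\<forall>W\<in>\<W>. \<exists>i\<in>I. \<forall>b. f i b W \<in> \<L>"
    using W(1) L(2) by (auto simp: branching_def)
  then obtain j where j: "\<And>W. W \<in> \<W> \<Longrightarrow> j W \<in> I \<and> (\<forall>b. f (j W) b W \<in> \<L>)" by metis
  have "\<W> = (\<Union>i\<in>I. {W \<in> \<W>. j W = i})" using j by auto
  then have "card \<W> \<le> (\<Sum>i\<in>I. card {W \<in> \<W>. j W = i})"
    using card_UN_le[OF \<open>finite I\<close>] by metis
  then have "\<not> (\<forall>i\<in>I. card {W \<in> \<W>. j W = i} \<le> n i)"
    using W(3) sum_mono[of I "\<lambda>i. card {W \<in> \<W>. j W = i}" n] by force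
  then obtain i where i: "i \<in> I" "n i \<le> card {W \<in> \<W>. j W = i}" by auto
  then obtain \<U> where u: "\<U> \<subseteq> {W \<in> \<W>. j W = i}" "card \<U> = n i" "finite \<U>"
    by (meson obtain_subset_with_card_n)
  have UW: "W \<in> \<W>" "j W = i" if "W \<in> \<U>" for W
    using that u(1) by auto
  have fL: "f i (b i) W \<in> \<L>" if "W \<in> \<U>" for W
    using UW[OF that] j by blast
  have WX: "W \<subseteq> X" "W \<subseteq> V' i" if "W \<in> \<U>" for W
    using UW(1)[OF that] W(1,5) outer_regularD(2)[OF L(1)] i(1) by blast+
  have dis: "disjnt (f i (b i) A) (f i (b i) B)" if "A \<in> \<U>" "B \<in> \<U>" "A \<noteq> B" for A B
    using disj[OF i(1) WX(1) WX(1)] that W(4) UW(1) by (meson pairwiseD)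
  \<comment> \<open>The halves are nonempty and disjoint, so different members yield different
    halves and the count survives.\<close>
  have inj: "inj_on (f i (b i)) \<U>"
  proof (rule inj_onI, rule ccontr)
    fix A B assume "A \<in> \<U>" "B \<in> \<U>" "f i (b i) A = f i (b i) B" "A \<noteq> B"
    then show False using dis[of A B] outer_regularD(3)[OF L(1) fL] by (auto simp: disjnt_def)
  qed
  have "full (V i) (n i)"
    unfolding full_def
  proof (intro exI conjI)
    show "card (f i (b i) ` \<U>) = n i" using inj u by (simp add: card_image)
    show "pairwise disjnt (f i (b i) ` \<U>)"
      using dis by (auto simp: pairwise_def)
    show "\<Union> (f i (b i) ` \<U>) \<subseteq> V i"
      using V[OF i(1)] WX by (intro UN_least) auto
  qed (use u fL in auto)
  then show False using none i by blast
qed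

section \<open>Cantor schemes\<close>

text \<open>Normality is used twice: to separate \<open>U\<close> from \<open>W\<close>, and
  \<open>U \<union> W\<close> from the closed set \<open>X - V\<close>. Intersecting the resulting
  neighbourhoods keeps their closures inside \<open>V\<close>, as far as \<open>X\<close> is
  concerned.\<close>

lemma disjoint_compact_shrink:
  fixes X :: "'a::t4_space set"
  assumes "compact X" "compact U" "compact W" "disjnt U W" "U \<subseteq> V" "W \<subseteq> V" "open V"
  obtains A B where "open A" "open B" "U \<subseteq> A" "W \<subseteq> B" "X \<inter> closure A \<subseteq> V" "X \<inter> closure B \<subseteq> V" "disjnt A B"
proof -
  obtain A B where AB: "open A" "open B" "U \<subseteq> A" "W \<subseteq> B" "A \<inter> B = {}"
    using t4_space[of U W] assms by (auto simp: compact_imp_closed disjnt_def)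
  have "closed (X - V)" using assms by (simp add: compact_imp_closed compact_diff)
  moreover have "closed (U \<union> W)" using assms by (simp add: compact_imp_closed closed_Un)
  ultimately obtain C D where CD: "open C" "open D" "U \<union> W \<subseteq> C" "X - V \<subseteq> D" "C \<inter> D = {}"
    using t4_space[of "U \<union> W" "X - V"] assms by blast
  have "closure C \<inter> D = {}" using CD by (simp add: open_Int_closure_eq_empty Int_commute)
  then have "X \<inter> closure C \<subseteq> V" using CD by auto
  then have "X \<inter> closure (A \<inter> C) \<subseteq> V" "X \<inter> closure (B \<inter> C) \<subseteq> V"
    using closure_mono[of "A \<inter> C" C] closure_mono[of "B \<inter> C" C] by auto
  then show ?thesis
    using AB CD by (intro that[of "A \<inter> C" "B \<inter> C"]) (auto simp: disjnt_def)
qed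

text \<open>Any neighbourhood of a member contains two disjoint members, so a binary tree of members
  with shrinking neighbourhoods can be grown; outer regularity puts the limit along each branch back
  into \<L>.\<close>

lemma perfect_family_Cantor_scheme:
  fixes X :: "'a::t4_space set"
  assumes X: "compact X" and L: "outer_regular X \<L>" and perf: "\<L> \<subseteq> derived_family X \<L>" and ne: "U\<^sub>0 \<in> \<L>"
  obtains E :: "(nat \<Rightarrow> bool) \<Rightarrow> 'a set"
    where "\<And>\<sigma>. E \<sigma> \<in> \<L>" "\<And>\<sigma> \<tau>. \<sigma> \<noteq> \<tau> \<Longrightarrow> disjnt (E \<sigma>) (E \<tau>)"
proof -
  \<comment> \<open>A member is paired with a neighbourhood because only the neighbourhoods are
    nested along a branch; the members need not be.\<close>
  define node where "node = {(U, V). U \<in> \<L> \<and> open V \<and> U \<subseteq> V}"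
  define split where "split p c \<longleftrightarrow> (\<forall>b. c b \<in> node \<and> X \<inter> closure (snd (c b)) \<subseteq> snd p) \<and>
    disjnt (snd (c True)) (snd (c False))" for p :: "'a set \<times> 'a set" and c :: "bool \<Rightarrow> 'a set \<times> 'a set"
  have "\<exists>c. split p c" if p: "p \<in> node" for p
  proof -
    obtain U V where UV: "p = (U, V)" "U \<in> \<L>" "open V" "U \<subseteq> V" using p by (auto simp: node_def)
    have "U \<in> derived_family X \<L>" using UV perf by blast
    then obtain \<W> where W: "\<W> \<subseteq> \<L>" "card \<W> = 2" "pairwise disjnt \<W>" "\<Union>\<W> \<subseteq> V"
      using UV(3,4) by (rule derived_familyE)
    then obtain P Q where PQ: "\<W> = {P, Q}" "P \<noteq> Q" by (auto simp: card_2_iff)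
    have "disjnt P Q" "P \<in> \<L>" "Q \<in> \<L>" "P \<subseteq> V" "Q \<subseteq> V"
      using W PQ by (auto simp: pairwise_def)
    moreover from this obtain A B where "open A" "open B" "P \<subseteq> A" "Q \<subseteq> B"
      "X \<inter> closure A \<subseteq> V" "X \<inter> closure B \<subseteq> V" "disjnt A B"
      using disjoint_compact_shrink[OF X outer_regularD(1)[OF L] outer_regularD(1)[OF L], of P Q V] UV(3)
      by blast
    ultimately show ?thesis
      using UV by (intro exI[of _ "\<lambda>b. if b then (P, A) else (Q, B)"]) (auto simp: node_def split_def)
  qed
  then obtain c where split: "\<And>p. p \<in> node \<Longrightarrow> split p (c p)"
    by metis
  then have c: "\<And>p b. p \<in> node \<Longrightarrow> c p b \<in> node \<and> X \<inter> closure (snd (c p b)) \<subseteq> snd p"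
    and cd: "\<And>p. p \<in> node \<Longrightarrow> disjnt (snd (c p True)) (snd (c p False))"
    unfolding split_def by blast+
  define N where "N \<sigma> = rec_nat (U\<^sub>0, UNIV) (\<lambda>n p. c p (\<sigma> n))" for \<sigma> :: "nat \<Rightarrow> bool"
  have N0: "N \<sigma> 0 = (U\<^sub>0, UNIV)" and NS: "N \<sigma> (Suc n) = c (N \<sigma> n) (\<sigma> n)" for \<sigma> n
    by (simp_all add: N_def)
  have Nn: "N \<sigma> n \<in> node" for \<sigma> n
    by (induction n) (use ne c in \<open>auto simp: N0 NS node_def\<close>)
  have step: "X \<inter> closure (snd (N \<sigma> (Suc n))) \<subseteq> snd (N \<sigma> n)" for \<sigma> n
    using c[OF Nn] NS by metis
  have anti: "X \<inter> snd (N \<sigma> n) \<subseteq> snd (N \<sigma> m)" if "m \<le> n" for \<sigma> m n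
    using that
  proof (induction rule: dec_induct)
    case (step n)
    then show ?case using \<open>X \<inter> closure (snd (N \<sigma> (Suc n))) \<subseteq> snd (N \<sigma> n)\<close>
        closure_subset[of "snd (N \<sigma> (Suc n))"] by auto
  qed auto
  \<comment> \<open>Each closure lies, within \<open>X\<close>, in the preceding neighbourhood, so
    \<open>E \<sigma>\<close> is also inside all the open neighbourhoods and inherits their
    disjointness.\<close>
  define E where "E \<sigma> = X \<inter> (\<Inter>n. closure (snd (N \<sigma> n)))" for \<sigma>
  have EN: "E \<sigma> \<subseteq> X \<inter> snd (N \<sigma> n)" for \<sigma> n
    using step[of \<sigma> n] unfolding E_def by auto
  have "E \<sigma> \<in> \<L>" for \<sigma>
  proof (rule outer_regularI[OF L])
    show "compact (E \<sigma>)" unfolding E_def using X by (intro compact_Int_closed) auto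
    show "E \<sigma> \<subseteq> X" by (auto simp: E_def)
  next
    fix V assume V: "open V" "E \<sigma> \<subseteq> V"
    show "\<exists>W\<in>\<L>. W \<subseteq> V"
    \<comment> \<open>If \<open>V\<close> contained no member, every
      \<open>fst (N \<sigma> m)\<close> would have a point outside \<open>V\<close>, and compactness
      of \<open>X - V\<close> would produce a point of \<open>E \<sigma>\<close> outside
      \<open>V\<close>.\<close>
    proof (rule ccontr)
      assume no: "\<not> (\<exists>W\<in>\<L>. W \<subseteq> V)"
      have "(X - V) \<inter> (\<Inter>n\<in>UNIV. closure (snd (N \<sigma> n))) \<noteq> {}"
      proof (rule compact_imp_fip_image)
        show "compact (X - V)" using X V by (simp add: compact_diff)
        fix I :: "nat set" assume I: "finite I"
        define m where "m = Max (insert 0 I)"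
        have m: "n \<le> m" if "n \<in> I" for n using that I by (auto simp: m_def)
        have F: "fst (N \<sigma> m) \<in> \<L>" "fst (N \<sigma> m) \<subseteq> snd (N \<sigma> m)"
          using Nn[of \<sigma> m] by (auto simp: node_def)
        then obtain x where x: "x \<in> fst (N \<sigma> m)" "x \<notin> V" using no by blast
        then have "x \<in> X \<inter> snd (N \<sigma> m)" using F outer_regularD(2)[OF L] by blast
        then have "x \<in> closure (snd (N \<sigma> n))" if "n \<in> I" for n
          using anti[OF m[OF that], of \<sigma>] closure_subset by blast
        then show "(X - V) \<inter> (\<Inter>n\<in>I. closure (snd (N \<sigma> n))) \<noteq> {}"
          using x \<open>x \<in> X \<inter> snd (N \<sigma> m)\<close> by blast
      qed auto
      then show False using V by (auto simp: E_def)
    qed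
  qed
  moreover have "disjnt (E \<sigma>) (E \<tau>)" if ne: "\<sigma> \<noteq> \<tau>" for \<sigma> \<tau>
  proof -
    \<comment> \<open>Up to the first disagreement both branches visit the same node, and they then
      enter its two children, whose neighbourhoods are disjoint.\<close>
    define n where "n = (LEAST n. \<sigma> n \<noteq> \<tau> n)"
    have "\<exists>n. \<sigma> n \<noteq> \<tau> n" using ne by auto
    then have n: "\<sigma> n \<noteq> \<tau> n"
      unfolding n_def by (rule LeastI_ex)
    have below: "\<sigma> m = \<tau> m" if "m < n" for m
      using that not_less_Least[of m "\<lambda>n. \<sigma> n \<noteq> \<tau> n"] unfolding n_def by simp
    have "m \<le> n \<Longrightarrow> N \<sigma> m = N \<tau> m" for m
      by (induction m) (use below in \<open>auto simp: N0 NS\<close>)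
    then have "N \<sigma> n = N \<tau> n" by simp
    then have "disjnt (snd (N \<sigma> (Suc n))) (snd (N \<tau> (Suc n)))"
      using cd[OF Nn[of \<sigma> n]] n unfolding NS
      by (cases "\<sigma> n"; cases "\<tau> n") (auto simp: disjnt_sym)
    then show ?thesis using EN[of \<sigma> "Suc n"] EN[of \<tau> "Suc n"]
      unfolding disjnt_def by blast
  qed
  ultimately show ?thesis using that by blast
qed

text \<open>Cantor's diagonal argument.\<close>

lemma uncountable_binary_sequences: "uncountable (UNIV :: (nat \<Rightarrow> bool) set)"
proof
  assume "countable (UNIV :: (nat \<Rightarrow> bool) set)"
  then obtain f :: "nat \<Rightarrow> nat \<Rightarrow> bool" where f: "range f = UNIV"
    by (metis UNIV_not_empty uncountable_def)
  then obtain n where "(\<lambda>k. \<not> f k k) = f n" by (metis UNIV_I image_iff)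
  from fun_cong[OF this, of n] show False by simp
qed

section \<open>Compact sets containing large connected sets\<close>

definition wide :: "'a::metric_space set \<Rightarrow> real \<Rightarrow> 'a set set"
  where "wide X c = {U. compact U \<and> U \<subseteq> X \<and>
    (\<exists>C\<subseteq>U. connected C \<and> (\<exists>x\<in>C. \<exists>y\<in>C. c \<le> dist x y))}"

lemma compact_Hausdorff_top_of_set:
  fixes U :: "'a::metric_space set"
  assumes "compact U"
  shows "compact_space (top_of_set U)" "Hausdorff_space (top_of_set U)"
  using assms by (simp_all add: compact_space_subtopology Hausdorff_space_subtopology)

text \<open>The cut wire fence theorem in the compact Hausdorff space \<open>U\<close>, translated
  into closed subsets of the ambient space.\<close>

lemma connected_or_separated:
  fixes U :: "'a::metric_space set"
  assumes U: "compact U" and "x \<in> U" and T: "closed T" "T \<subseteq> U"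
  shows "(\<exists>C\<subseteq>U. connected C \<and> x \<in> C \<and> C \<inter> T \<noteq> {}) \<or>
    (\<exists>A B. closed A \<and> closed B \<and> A \<union> B = U \<and> A \<inter> B = {} \<and> x \<in> A \<and> T \<subseteq> B)"
proof (cases "\<exists>C\<subseteq>U. connected C \<and> x \<in> C \<and> C \<inter> T \<noteq> {}")
  case no: False
  have "separated_between (top_of_set U) {x} T"
  proof (rule cut_wire_fence_theorem)
    show "closedin (top_of_set U) {x}" "closedin (top_of_set U) T"
      using assms by (auto intro: closed_subset)
    fix C assume "connectedin (top_of_set U) C"
    then have "connected C" "C \<subseteq> U"
      by (auto simp: connectedin_subtopology)
    then show "disjnt C {x} \<or> disjnt C T"
      using no by (auto simp: disjnt_def)
  qed (use compact_Hausdorff_top_of_set[OF U] in auto)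
  then obtain A B where "closedin (top_of_set U) A" "closedin (top_of_set U) B"
    "A \<union> B = U" "disjnt A B" "{x} \<subseteq> A" "T \<subseteq> B"
    unfolding separated_between_alt by auto
  moreover have "closed U" using U by (rule compact_imp_closed)
  ultimately have "closed A \<and> closed B \<and> A \<union> B = U \<and> A \<inter> B = {} \<and> x \<in> A \<and> T \<subseteq> B"
    by (metis closedin_closed_trans disjnt_def insert_subset)
  then show ?thesis by blast
qed blast

section \<open>Boundary bumping and limits of wide sets\<close>

text \<open>If nothing connected joins \<open>x\<close> to the sphere within the ball, then
  \<open>C \<inter> cball z s\<close> splits into closed parts, one containing \<open>x\<close> and
  the other the sphere points; this splitting extends to a separation of \<open>C\<close>.\<close>

lemma boundary_bumping_cball:
  fixes C :: "'a::metric_space set"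
  assumes C: "compact C" "connected C" and x: "x \<in> C" "dist z x \<le> s" and y: "y \<in> C" "s < dist z y"
  shows "\<exists>D\<subseteq>C \<inter> cball z s. connected D \<and> x \<in> D \<and> (\<exists>w\<in>D. dist z w = s)"
proof -
  define K where "K = C \<inter> cball z s"
  have K: "compact K" "closed K" unfolding K_def using C by (auto intro: compact_Int_closed compact_imp_closed)
  define T where "T = {p \<in> K. dist z p = s}"
  have "T = K \<inter> {p. dist z p = s}" by (auto simp: T_def)
  moreover have "closed {p. dist z p = s}"
    by (intro closed_Collect_eq continuous_intros)
  ultimately have "closed T" "T \<subseteq> K" "x \<in> K" using K x by (auto simp: K_def)
  then consider D where "D \<subseteq> K" "connected D" "x \<in> D" "D \<inter> T \<noteq> {}"
    | A B where "closed A" "closed B" "A \<union> B = K" "A \<inter> B = {}" "x \<in> A" "T \<subseteq> B"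
    using connected_or_separated[OF K(1), of x T] by blast
  then show ?thesis
  proof cases
    case 1
    then show ?thesis unfolding K_def T_def by (intro exI[of _ D]) auto
  next
    case 2
    \<comment> \<open>The part of \<open>C\<close> off the open ball joins the side of the sphere;
      it can meet \<open>A\<close> only on the sphere, which lies in \<open>B\<close>.\<close>
    define B' where "B' = B \<union> (C - ball z s)"
    have "closed B'" unfolding B'_def using 2 C by (intro closed_Un closed_Diff) (auto simp: compact_imp_closed)
    have "C \<subseteq> A \<union> B'"
    proof
      fix p assume p: "p \<in> C"
      show "p \<in> A \<union> B'"
      proof (cases "dist z p < s")
        case True
        then have "p \<in> K" using p by (simp add: K_def)
        then show ?thesis using 2 by (auto simp: B'_def)
      qed (use p in \<open>auto simp: B'_def\<close>)
    qed
    moreover have "A \<inter> B' = {}"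
    proof (rule ccontr)
      assume "A \<inter> B' \<noteq> {}"
      then obtain p where p: "p \<in> A" "p \<in> C - ball z s" using 2(4) unfolding B'_def by blast
      then have "p \<in> T" using 2(3) by (force simp: K_def T_def)
      then show False using p 2 by blast
    qed
    moreover have "A \<inter> C \<noteq> {}" "B' \<inter> C \<noteq> {}" using 2 x y by (auto simp: B'_def)
    ultimately have False
      using connected_closedD[OF C(2), of A B'] 2 \<open>closed B'\<close> by auto
    then show ?thesis ..
  qed
qed

text \<open>Instead of a limit of connected sets, pairs of far points joined by them are followed; a
  cluster pair in \<open>X \<times> X\<close> turns out to be joined inside
  \<open>U\<close>.\<close>

lemma outer_regular_wide:
  fixes X :: "'a::metric_space set"
  assumes X: "compact X"
  shows "outer_regular X (wide X c)"
  unfolding outer_regular_def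
proof (intro conjI allI impI)
  show "wide X c \<subseteq> {U. compact U \<and> U \<subseteq> X \<and> U \<noteq> {}}" by (auto simp: wide_def)
next
  fix U assume U: "compact U" "U \<subseteq> X" and near: "\<forall>V. open V \<longrightarrow> U \<subseteq> V \<longrightarrow> (\<exists>W\<in>wide X c. W \<subseteq> V)"
  define joined where "joined V = {p \<in> X \<times> X. c \<le> dist (fst p) (snd p) \<and>
    (\<exists>C\<subseteq>X \<inter> V. connected C \<and> fst p \<in> C \<and> snd p \<in> C)}" for V
  define \<V> where "\<V> = {V. open V \<and> U \<subseteq> V}"
  \<comment> \<open>Finitely many neighbourhoods of \<open>U\<close> intersect in another one, which
    contains a wide set; this is the finite intersection property.\<close>
  have "(X \<times> X) \<inter> (\<Inter>V\<in>\<V>. closure (joined V)) \<noteq> {}"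
  proof (rule compact_imp_fip_image)
    show "compact (X \<times> X)" using X by (intro compact_Times)
    fix \<V>' assume V': "finite \<V>'" "\<V>' \<subseteq> \<V>"
    then have "open (\<Inter>\<V>')" "U \<subseteq> \<Inter>\<V>'" by (auto simp: \<V>_def)
    with near obtain W where W: "W \<in> wide X c" "W \<subseteq> \<Inter>\<V>'" by blast
    then obtain C x y where C: "C \<subseteq> W" "connected C" "x \<in> C" "y \<in> C" "c \<le> dist x y" "W \<subseteq> X"
      unfolding wide_def by blast
    have "(x, y) \<in> joined V" if "V \<in> \<V>'" for V
    proof -
      have "C \<subseteq> X \<inter> V" using C W that by blast
      then show ?thesis using C unfolding joined_def by auto
    qed
    then have "(x, y) \<in> (X \<times> X) \<inter> (\<Inter>V\<in>\<V>'. closure (joined V))"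
      using C closure_subset by fastforce
    then show "(X \<times> X) \<inter> (\<Inter>V\<in>\<V>'. closure (joined V)) \<noteq> {}" by blast
  qed auto
  then obtain x y where xy: "x \<in> X" "y \<in> X" and cl: "\<And>V. V \<in> \<V> \<Longrightarrow> (x, y) \<in> closure (joined V)"
    by auto
  have meet: "\<exists>a\<in>A. \<exists>b\<in>B. (a, b) \<in> joined V" if "open A" "open B" "x \<in> A" "y \<in> B" "V \<in> \<V>" for A B V
  proof -
    have "open (A \<times> B)" "(x, y) \<in> A \<times> B" using that by (auto intro: open_Times)
    then have "(A \<times> B) \<inter> joined V \<noteq> {}"
      using cl[OF \<open>V \<in> \<V>\<close>] open_Int_closure_eq_empty by blast
    then show ?thesis by auto
  qed
  have inU: "p \<in> U" if "\<And>A V. open A \<Longrightarrow> p \<in> A \<Longrightarrow> V \<in> \<V> \<Longrightarrow> A \<inter> V \<noteq> {}" for p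
  proof (rule ccontr)
    assume "p \<notin> U"
    then obtain A V where "open A" "open V" "{p} \<subseteq> A" "U \<subseteq> V" "A \<inter> V = {}"
      using t4_space[of "{p}" U] U by (auto simp: compact_imp_closed)
    then show False using that[of A V] by (auto simp: \<V>_def)
  qed
  have "x \<in> U"
  proof (rule inU)
    fix A V assume "open A" "x \<in> A" "V \<in> \<V>"
    then show "A \<inter> V \<noteq> {}" using meet[of A UNIV V] by (force simp: joined_def)
  qed
  have "y \<in> U"
  proof (rule inU)
    fix A V assume "open A" "y \<in> A" "V \<in> \<V>"
    then show "A \<inter> V \<noteq> {}" using meet[of UNIV A V] by (force simp: joined_def)
  qed
  have "closed {p. c \<le> dist (fst p) (snd p)}"
    by (intro closed_Collect_le continuous_intros)
  moreover have "joined UNIV \<subseteq> {p. c \<le> dist (fst p) (snd p)}" by (auto simp: joined_def)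
  ultimately have "closure (joined UNIV) \<subseteq> {p. c \<le> dist (fst p) (snd p)}"
    by (rule closure_minimal[rotated])
  moreover have "UNIV \<in> \<V>" by (simp add: \<V>_def)
  ultimately have c: "c \<le> dist x y" using cl[of UNIV] by auto
  have "\<exists>C\<subseteq>U. connected C \<and> x \<in> C \<and> C \<inter> {y} \<noteq> {}"
  proof (rule ccontr)
    \<comment> \<open>A separation of \<open>x\<close> from \<open>y\<close> in \<open>U\<close>
      thickens to disjoint open \<open>A\<close> and \<open>B\<close>. Pairs close to
      \<open>(x, y)\<close> would be joined inside the neighbourhood \<open>A \<union> B\<close> by
      a connected set meeting both.\<close>
    assume "\<not> (\<exists>C\<subseteq>U. connected C \<and> x \<in> C \<and> C \<inter> {y} \<noteq> {})"
    then obtain P Q where PQ: "closed P" "closed Q" "P \<union> Q = U" "P \<inter> Q = {}" "x \<in> P" "y \<in> Q"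
      using connected_or_separated[OF U(1) \<open>x \<in> U\<close>, of "{y}"] \<open>y \<in> U\<close> by auto
    then obtain A B where AB: "open A" "open B" "P \<subseteq> A" "Q \<subseteq> B" "A \<inter> B = {}"
      using t4_space[of P Q] by blast
    have "A \<union> B \<in> \<V>" using AB PQ by (auto simp: \<V>_def)
    then obtain a b where ab: "a \<in> A" "b \<in> B" "(a, b) \<in> joined (A \<union> B)"
      using meet[of A B "A \<union> B"] AB PQ by blast
    then obtain C where "C \<subseteq> A \<union> B" "connected C" "a \<in> C" "b \<in> C"
      by (auto simp: joined_def)
    then show False using connectedD[of C A B] AB ab by auto
  qed
  then show "U \<in> wide X c" using U c unfolding wide_def by blast
qed

text \<open>Boundary bumping leads from \<open>x\<close>, within \<open>r\<close> of the centre, to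
  the sphere of radius \<open>3 * r\<close>, so the end points are at least \<open>2 * r\<close>
  apart.\<close>

lemma wide_pieces:
  assumes "compact C" "connected C" "x \<in> C" "y \<in> C" "0 < r" "dist z x < r" "3 * r < dist z y"
  shows "\<exists>D\<subseteq>C \<inter> cball z (3 * r). connected D \<and> (\<exists>u\<in>D. \<exists>v\<in>D. 2 * r \<le> dist u v)"
proof -
  obtain D w where D: "D \<subseteq> C \<inter> cball z (3 * r)" "connected D" "x \<in> D" "w \<in> D" "dist z w = 3 * r"
    using boundary_bumping_cball[of C x z "3 * r" y] assms by fastforce
  have "dist z w \<le> dist z x + dist x w" by (rule dist_triangle)
  then have "2 * r \<le> dist x w" using D assms by simp
  then show ?thesis using D by blast
qed

text \<open>The closure of the large connected set stays inside the compact \<open>U\<close>, and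
  \<open>0 < c\<close> keeps its two far points distinct.\<close>

lemma wide_nondegenerate_continuum:
  fixes X :: "'a::metric_space set"
  assumes "U \<in> wide X c" "0 < c"
  shows "\<exists>C\<subseteq>U. subcontinuum C X \<and> nondegenerate C"
proof -
  obtain C x y where C: "compact U" "U \<subseteq> X" "C \<subseteq> U" "connected C" "x \<in> C" "y \<in> C" "c \<le> dist x y"
    using assms unfolding wide_def by blast
  have "closure C \<subseteq> U" using C by (simp add: closure_minimal compact_imp_closed)
  moreover have "compact (closure C)"
    using C \<open>closure C \<subseteq> U\<close> by (metis closed_closure compact_Int_closed inf.absorb_iff2)
  moreover have "x \<in> closure C" "y \<in> closure C" "x \<noteq> y"
    using C assms closure_subset by auto
  ultimately show ?thesis
    using C by (intro exI[of _ "closure C"])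
      (auto simp: subcontinuum_def continuum_def nondegenerate_def connected_imp_connected_closure)
qed

section \<open>Word length and growth\<close>

lemma (in group) foldr_mult_closed:
  "set ws \<subseteq> carrier G \<Longrightarrow> foldr (\<otimes>) ws \<one> \<in> carrier G"
  by (induction ws) auto

lemma (in group) foldr_mult_append:
  "set us \<subseteq> carrier G \<Longrightarrow> set vs \<subseteq> carrier G \<Longrightarrow>
    foldr (\<otimes>) (us @ vs) \<one> = foldr (\<otimes>) us \<one> \<otimes> foldr (\<otimes>) vs \<one>"
  by (induction us) (auto simp: m_assoc foldr_mult_closed)

lemma (in group) word_letters_carrier:
  assumes "finite_generating_set G S"
  shows "S \<union> m_inv G ` S \<subseteq> carrier G"
  using assms by (auto simp: finite_generating_set_def)

text \<open>\<open>word_length\<close> is a \<open>LEAST\<close>, so its value is meaningful only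
  once some word for \<open>h\<close> exists.\<close>

lemma (in group) word_exists:
  assumes S: "finite_generating_set G S" and h: "h \<in> carrier G"
  shows "\<exists>ws. set ws \<subseteq> S \<union> m_inv G ` S \<and> foldr (\<otimes>) ws \<one> = h"
proof -
  have "h \<in> generate G S" using S h by (simp add: finite_generating_set_def)
  then show ?thesis
  proof induction
    case one
    show ?case by (rule exI[of _ "[]"]) auto
  next
    case (incl h)
    then show ?case using word_letters_carrier[OF S] by (intro exI[of _ "[h]"]) auto
  next
    case (inv h)
    then show ?case using word_letters_carrier[OF S] by (intro exI[of _ "[inv h]"]) auto
  next
    case (eng g h)
    then obtain us vs where "set us \<subseteq> S \<union> m_inv G ` S" "foldr (\<otimes>) us \<one> = g"
      "set vs \<subseteq> S \<union> m_inv G ` S" "foldr (\<otimes>) vs \<one> = h" by blast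
    then show ?case
      using word_letters_carrier[OF S] foldr_mult_append[of us vs]
      by (intro exI[of _ "us @ vs"]) auto
  qed
qed

lemma (in group) word_length_le:
  assumes "set ws \<subseteq> S \<union> m_inv G ` S" "foldr (\<otimes>) ws \<one> = h"
  shows "word_length G S h \<le> length ws"
  unfolding word_length_def using assms by (intro Least_le) blast

lemma (in group) word_length_attained:
  assumes "finite_generating_set G S" "h \<in> carrier G"
  shows "\<exists>ws. set ws \<subseteq> S \<union> m_inv G ` S \<and> length ws = word_length G S h \<and> foldr (\<otimes>) ws \<one> = h"
proof -
  have "\<exists>n ws. set ws \<subseteq> S \<union> m_inv G ` S \<and> length ws = n \<and> foldr (\<otimes>) ws \<one> = h"
    using word_exists[OF assms] by blast
  then show ?thesis unfolding word_length_def by (rule LeastI_ex)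
qed

lemma (in group) word_length_one: "word_length G S \<one> = 0"
  using word_length_le[of "[]" S \<one>] by simp

lemma (in group) word_length_mult:
  assumes S: "finite_generating_set G S" and "g \<in> carrier G" "h \<in> carrier G"
  shows "word_length G S (g \<otimes> h) \<le> word_length G S g + word_length G S h"
proof -
  obtain us vs where "set us \<subseteq> S \<union> m_inv G ` S" "length us = word_length G S g" "foldr (\<otimes>) us \<one> = g"
    "set vs \<subseteq> S \<union> m_inv G ` S" "length vs = word_length G S h" "foldr (\<otimes>) vs \<one> = h"
    using word_length_attained[OF S] assms by meson
  then show ?thesis
    using word_letters_carrier[OF S] foldr_mult_append[of us vs] word_length_le[of "us @ vs" S "g \<otimes> h"]
    by auto
qed

text \<open>There are finitely many words of bounded length over a finite alphabet. The
  \<open>card\<close> in \<open>growth\<close>, which is 0 for infinite sets, is thereby a true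
  count.\<close>

lemma (in group) finite_word_ball:
  assumes S: "finite_generating_set G S"
  shows "finite {h \<in> carrier G. word_length G S h \<le> k}"
proof (rule finite_subset)
  let ?W = "{ws. set ws \<subseteq> S \<union> m_inv G ` S \<and> length ws \<le> k}"
  show "{h \<in> carrier G. word_length G S h \<le> k} \<subseteq> (\<lambda>ws. foldr (\<otimes>) ws \<one>) ` ?W"
  proof
    fix h assume "h \<in> {h \<in> carrier G. word_length G S h \<le> k}"
    then show "h \<in> (\<lambda>ws. foldr (\<otimes>) ws \<one>) ` ?W"
      using word_length_attained[OF S, of h] by force
  qed
  have "finite (S \<union> m_inv G ` S)" using S by (simp add: finite_generating_set_def)
  then show "finite ((\<lambda>ws. foldr (\<otimes>) ws \<one>) ` ?W)"
    by (intro finite_imageI finite_lists_length_le)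
qed

text \<open>For large \<open>k\<close> the ball of radius \<open>k * N\<close> has at most
  \<open>(3 / 2) ^ k\<close> elements; the remaining factor \<open>(4 / 3) ^ k\<close> of
  \<open>2 ^ k\<close> absorbs \<open>n\<close>.\<close>

lemma subexponential_growth_below_power_2:
  assumes "subexponential_growth G S" "0 < N"
  shows "\<exists>k. n * growth G S (k * N) < 2 ^ k"
proof -
  obtain L where L: "L \<le> 1" "(\<lambda>k. root k (real (growth G S k))) \<longlonglongrightarrow> L"
    using assms by (auto simp: subexponential_growth_def)
  \<comment> \<open>As \<open>1 < a\<close>, the roots are eventually below \<open>a\<close>; raised
    to the power \<open>k * N\<close>, this bound becomes \<open>(3 / 2) ^ k\<close>.\<close>
  define a where "a = root N (3 / 2)"
  have a: "1 < a" "a ^ N = 3 / 2" using assms(2) by (simp_all add: a_def)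
  have "eventually (\<lambda>k. root k (real (growth G S k)) < a) sequentially"
    using order_tendstoD(2)[OF L(2)] L(1) a(1) by simp
  then obtain M where M: "\<And>k. k \<ge> M \<Longrightarrow> root k (real (growth G S k)) < a"
    by (auto simp: eventually_sequentially)
  \<comment> \<open>Requiring \<open>k\<close> to be at least 1 keeps the degree
    \<open>k * N\<close> positive, since \<open>root 0\<close> is constantly 0.\<close>
  have bound: "real (growth G S (k * N)) \<le> (3 / 2) ^ k" if k: "k \<ge> max 1 M" for k
  proof -
    have kN: "0 < k * N" "M \<le> k * N"
      using k assms(2) by (auto intro: le_trans[of M k])
    have "real (growth G S (k * N)) = root (k * N) (real (growth G S (k * N))) ^ (k * N)"
      using kN by (intro real_root_pow_pos2[symmetric]) auto
    also have "\<dots> \<le> a ^ (k * N)"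
      using M[OF kN(2)] kN(1) by (intro power_mono real_root_ge_zero) auto
    also have "\<dots> = (3 / 2) ^ k"
      by (simp only: mult.commute[of k] power_mult a(2))
    finally show ?thesis .
  qed
  obtain j where j: "real n < (4 / 3) ^ j"
    using real_arch_pow[of "4 / 3" "real n"] by auto
  define k where "k = max j (max 1 M)"
  have "real (n * growth G S (k * N)) \<le> real n * (3 / 2) ^ k"
    using bound[of k] by (simp add: k_def mult_left_mono)
  also have "\<dots> < (4 / 3) ^ k * (3 / 2) ^ k"
  proof (rule mult_strict_right_mono)
    show "real n < (4 / 3) ^ k"
      using j power_increasing[of j k "4 / 3 :: real"] unfolding k_def by linarith
  qed simp
  also have "\<dots> = 2 ^ k" by (simp flip: power_mult_distrib)
  finally have "real (n * growth G S (k * N)) < real (2 ^ k)" by simp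
  then show ?thesis by (intro exI[of _ k]) (simp only: of_nat_less_iff)
qed

section \<open>Expansive actions\<close>

lemma action_homeomorphism:
  assumes "continuous_group_action G X \<phi>" "g \<in> carrier G"
  shows "bij_betw (\<phi> g) X X" "continuous_on X (\<phi> g)"
proof -
  have "\<phi> g \<in> Homeo X"
    using assms by (auto simp: continuous_group_action_def hom_def HomeoGroup_def)
  then show "bij_betw (\<phi> g) X X" "continuous_on X (\<phi> g)"
    by (auto simp: Homeo_def Bij_def homeomorphism_def)
qed

lemma action_image:
  assumes "continuous_group_action G X \<phi>" "g \<in> carrier G"
  shows "\<phi> g ` X = X"
  using action_homeomorphism(1)[OF assms] by (simp add: bij_betw_def)

lemma action_mult:
  assumes act: "continuous_group_action G X \<phi>" and "g \<in> carrier G" "h \<in> carrier G" "x \<in> X"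
  shows "\<phi> (g \<otimes>\<^bsub>G\<^esub> h) x = \<phi> g (\<phi> h x)"
proof -
  have "\<phi> g \<in> Bij X" "\<phi> h \<in> Bij X" "\<phi> (g \<otimes>\<^bsub>G\<^esub> h) = \<phi> g \<otimes>\<^bsub>HomeoGroup X\<^esub> \<phi> h"
    using assms by (auto simp: continuous_group_action_def hom_def HomeoGroup_def Homeo_def)
  then show ?thesis
    using assms(4) by (simp add: HomeoGroup_def BijGroup_def compose_def)
qed

text \<open>A real supremum above \<open>c\<close> yields an element above \<open>c\<close> because
  the set is nonempty and bounded, the latter by compactness of \<open>X\<close>.\<close>

lemma expansive_at_pair:
  fixes X :: "'a::metric_space set"
  assumes act: "continuous_group_action G X \<phi>" and "group G" and "compact X" "x \<in> X" "y \<in> X"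
    and c: "c < (SUP g\<in>carrier G. dist (\<phi> g x) (\<phi> g y))"
  shows "\<exists>g\<in>carrier G. c < dist (\<phi> g x) (\<phi> g y)"
proof -
  interpret group G by fact
  have "bounded X" using assms(3) by (rule compact_imp_bounded)
  have "bdd_above ((\<lambda>g. dist (\<phi> g x) (\<phi> g y)) ` carrier G)"
  proof (rule bdd_aboveI2)
    fix g assume "g \<in> carrier G"
    then have "\<phi> g x \<in> X" "\<phi> g y \<in> X" using action_image[OF act] assms by blast+
    then show "dist (\<phi> g x) (\<phi> g y) \<le> diameter X"
      using \<open>bounded X\<close> by (rule diameter_bounded_bound[rotated])
  qed
  moreover have "carrier G \<noteq> {}" by blast
  ultimately show ?thesis using c by (simp add: less_cSUP_iff)
qed

text \<open>The pairs at distance at least \<open>e\<close> form a compact set, covered by the sets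
  of pairs that a single group element pushes more than \<open>c\<close> apart; a finite subcover
  gives \<open>F\<close>.\<close>

lemma expansive_uniform:
  fixes X :: "'a::metric_space set"
  assumes act: "continuous_group_action G X \<phi>" and "group G" and X: "compact X"
    and exp: "\<And>x y. x \<in> X \<Longrightarrow> y \<in> X \<Longrightarrow> x \<noteq> y \<Longrightarrow> c < (SUP g\<in>carrier G. dist (\<phi> g x) (\<phi> g y))"
    and "0 < e"
  shows "\<exists>F. finite F \<and> F \<subseteq> carrier G \<and>
    (\<forall>x\<in>X. \<forall>y\<in>X. e \<le> dist x y \<longrightarrow> (\<exists>g\<in>F. c \<le> dist (\<phi> g x) (\<phi> g y)))"
proof -
  define K where "K = (X \<times> X) \<inter> {p. e \<le> dist (fst p) (snd p)}"
  have "closed {p :: 'a \<times> 'a. e \<le> dist (fst p) (snd p)}"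
    by (intro closed_Collect_le continuous_intros)
  then have K: "compact K" unfolding K_def using X by (intro compact_Int_closed compact_Times)
  define spread where "spread g = {p \<in> X \<times> X. c < dist (\<phi> g (fst p)) (\<phi> g (snd p))}" for g
  \<comment> \<open>Continuity of \<open>\<phi> g\<close> is known on \<open>X\<close> only, so
    \<open>spread g\<close> is merely relatively open; open sets of the full product are chosen for
    the cover.\<close>
  have "\<exists>O'. open O' \<and> spread g = (X \<times> X) \<inter> O'" if g: "g \<in> carrier G" for g
  proof -
    have "continuous_on (X \<times> X) (\<lambda>p. dist (\<phi> g (fst p)) (\<phi> g (snd p)))"
      by (intro continuous_on_dist continuous_on_compose2[OF action_homeomorphism(2)[OF act g]]
          continuous_on_fst continuous_on_snd continuous_on_id) auto
    then have "openin (top_of_set (X \<times> X)) (X \<times> X \<inter> (\<lambda>p. dist (\<phi> g (fst p)) (\<phi> g (snd p))) -` {c<..})"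
      by (rule continuous_openin_preimage_gen) simp
    moreover have "X \<times> X \<inter> (\<lambda>p. dist (\<phi> g (fst p)) (\<phi> g (snd p))) -` {c<..} = spread g"
      by (auto simp: spread_def)
    ultimately show ?thesis by (simp add: openin_open)
  qed
  then obtain O' where O': "\<And>g. g \<in> carrier G \<Longrightarrow> open (O' g) \<and> spread g = (X \<times> X) \<inter> O' g"
    by metis
  have "K \<subseteq> (\<Union>g\<in>carrier G. O' g)"
  proof
    fix p assume p: "p \<in> K"
    then have p': "fst p \<in> X" "snd p \<in> X" "fst p \<noteq> snd p" using \<open>0 < e\<close> by (auto simp: K_def)
    then obtain g where "g \<in> carrier G" "c < dist (\<phi> g (fst p)) (\<phi> g (snd p))"
      using expansive_at_pair[OF act \<open>group G\<close> X] exp by blast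
    then have "p \<in> spread g" "g \<in> carrier G" using p by (auto simp: spread_def K_def)
    then show "p \<in> (\<Union>g\<in>carrier G. O' g)" using O' by blast
  qed
  then obtain F where F: "F \<subseteq> carrier G" "finite F" "K \<subseteq> (\<Union>g\<in>F. O' g)"
    using compactE_image[OF K, of "carrier G" O'] O' by blast
  have "\<exists>g\<in>F. c \<le> dist (\<phi> g x) (\<phi> g y)" if "x \<in> X" "y \<in> X" "e \<le> dist x y" for x y
  proof -
    have "(x, y) \<in> K" using that by (simp add: K_def)
    then obtain g where "g \<in> F" "(x, y) \<in> O' g" using F by blast
    then have "(x, y) \<in> spread g" using O' F that by blast
    then show ?thesis using \<open>g \<in> F\<close> by (intro bexI[of _ g]) (auto simp: spread_def)
  qed
  then show ?thesis using F by blast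
qed

text \<open>\<open>t b\<close> is a pair of a closed set to intersect with and a group element to apply afterwards;
  the two values of \<open>b\<close> give the two halves.\<close>

definition piece :: "('g \<Rightarrow> 'a \<Rightarrow> 'a) \<Rightarrow> (bool \<Rightarrow> 'a set \<times> 'g) \<Rightarrow> bool \<Rightarrow> 'a set \<Rightarrow> 'a set"
  where "piece \<phi> t b U = \<phi> (snd (t b)) ` (U \<inter> fst (t b))"

lemma disjnt_action_image:
  assumes "continuous_group_action G X \<phi>" "g \<in> carrier G" "A \<subseteq> X" "B \<subseteq> X" "disjnt A B"
  shows "disjnt (\<phi> g ` A) (\<phi> g ` B)"
proof -
  have "inj_on (\<phi> g) X" using action_homeomorphism(1)[OF assms(1,2)] by (simp add: bij_betw_def)
  then show ?thesis
    using assms(3-5) inj_on_image_Int[of "\<phi> g" X A B] by (simp add: disjnt_def)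
qed

lemma compact_piece:
  fixes X :: "'a::t2_space set"
  assumes act: "continuous_group_action G X \<phi>" and g: "snd (t b) \<in> carrier G" and "closed (fst (t b))"
    and U: "compact U" "U \<subseteq> X"
  shows "compact (piece \<phi> t b U) \<and> piece \<phi> t b U \<subseteq> X"
proof
  show "compact (piece \<phi> t b U)"
    unfolding piece_def
    using assms by (intro compact_continuous_image compact_Int_closed
        continuous_on_subset[OF action_homeomorphism(2)[OF act g]]) auto
  show "piece \<phi> t b U \<subseteq> X"
    using action_image[OF act g] U by (auto simp: piece_def)
qed

text \<open>The points of \<open>X\<close> in the cutting set whose image leaves \<open>V\<close>
  form a closed set, whose complement is the required \<open>V'\<close>. This is the continuity
  hypothesis of \<open>branching_derived_family\<close>.\<close>

lemma piece_neighbourhood: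
  fixes X :: "'a::t2_space set"
  assumes act: "continuous_group_action G X \<phi>" and X: "compact X" and g: "snd (t b) \<in> carrier G"
    and "closed (fst (t b))" and "open V" and UV: "piece \<phi> t b U \<subseteq> V"
  shows "\<exists>V'. open V' \<and> U \<subseteq> V' \<and> (\<forall>W\<subseteq>X. W \<subseteq> V' \<longrightarrow> piece \<phi> t b W \<subseteq> V)"
proof (intro exI conjI allI impI)
  let ?K = "X \<inter> fst (t b) \<inter> \<phi> (snd (t b)) -` (- V)"
  have "closed ?K"
    using assms by (intro continuous_closed_preimage continuous_on_subset[OF action_homeomorphism(2)[OF act g]])
      (auto simp: compact_imp_closed)
  then show "open (- ?K)" by (rule open_Compl)
  show "U \<subseteq> - ?K" using UV by (auto simp: piece_def)
  show "piece \<phi> t b W \<subseteq> V" if "W \<subseteq> X" "W \<subseteq> - ?K" for W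
    using that by (auto simp: piece_def)
qed

section \<open>The splitting procedure for wide sets\<close>

text \<open>A large connected set has pieces in balls around two far points of it. Taking centres
  from a finite net and expanding elements from \<open>F\<close> leaves finitely many
  indices.\<close>

lemma branching_wide:
  fixes X :: "'a::metric_space set" and F :: "'g set"
  assumes act: "continuous_group_action G X \<phi>" and X: "compact X" and "0 < c"
    and F: "finite F" "F \<subseteq> carrier G"
    and grow: "\<And>x y. x \<in> X \<Longrightarrow> y \<in> X \<Longrightarrow> c / 4 \<le> dist x y \<Longrightarrow> \<exists>g\<in>F. c \<le> dist (\<phi> g x) (\<phi> g y)"
  obtains I where "finite I" "\<forall>t\<in>I. \<forall>b. closed (fst (t b)) \<and> snd (t b) \<in> F"
    "\<forall>t\<in>I. disjnt (fst (t True)) (fst (t False))" "branching (piece \<phi>) I (wide X c)"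
proof -
  \<comment> \<open>With \<open>c = 8 * r\<close>, the pieces have spread
    \<open>2 * r = c / 4\<close>, the threshold in \<open>grow\<close>. Balls of radius
    \<open>3 * r\<close> whose centres are less than \<open>r\<close> from two points
    \<open>8 * r\<close> apart are disjoint.\<close>
  define r where "r = c / 8"
  have r: "0 < r" "c = 8 * r" using \<open>0 < c\<close> by (simp_all add: r_def)
  obtain Z where Z: "finite Z" "X \<subseteq> (\<Union>z\<in>Z. ball z r)"
    using compact_eq_totally_bounded[THEN iffD1, OF X, THEN conjunct2, rule_format, OF r(1)] by auto
  define tup where "tup = (\<lambda>(z :: 'a, z' :: 'a, g :: 'g, h :: 'g) b.
    if b then (cball z (3 * r), g) else (cball z' (3 * r), h))"
  define I where "I = tup ` {(z, z', g, h). (z, z', g, h) \<in> Z \<times> Z \<times> F \<times> F \<and> disjnt (cball z (3 * r)) (cball z' (3 * r))}"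
  show ?thesis
  proof (rule that[of I])
    show "finite I"
      unfolding I_def
    proof (rule finite_imageI, rule finite_subset)
      show "finite (Z \<times> Z \<times> F \<times> F)" using Z F by simp
    qed auto
    show "\<forall>t\<in>I. \<forall>b. closed (fst (t b)) \<and> snd (t b) \<in> F"
      by (auto simp: I_def tup_def)
    show "\<forall>t\<in>I. disjnt (fst (t True)) (fst (t False))"
      by (auto simp: I_def tup_def)
    \<comment> \<open>Treats the end \<open>x\<close> of the connected set; exchanging
      \<open>x\<close> and \<open>y\<close> treats the other end.\<close>
    have big: "\<exists>g\<in>F. \<phi> g ` (U \<inter> cball z (3 * r)) \<in> wide X c"
      if "compact U" "U \<subseteq> X" "C \<subseteq> U" "compact C" "connected C" "x \<in> C" "y \<in> C" "c \<le> dist x y" "dist z x < r" for U C x y z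
    proof -
      have "dist x y \<le> dist z x + dist z y" by (metis dist_commute dist_triangle)
      then have "3 * r < dist z y" using that r by linarith
      then have "\<exists>D\<subseteq>C \<inter> cball z (3 * r). connected D \<and> (\<exists>u\<in>D. \<exists>v\<in>D. 2 * r \<le> dist u v)"
        using that r(1) by (intro wide_pieces[of C x y r z]) auto
      then obtain D u v where D: "D \<subseteq> C \<inter> cball z (3 * r)" "connected D" "u \<in> D" "v \<in> D" "2 * r \<le> dist u v"
        by blast
      have "u \<in> X" "v \<in> X" "c / 4 \<le> dist u v" using D that r by auto
      then obtain g where g: "g \<in> F" "c \<le> dist (\<phi> g u) (\<phi> g v)" using grow by blast
      have cont: "continuous_on X (\<phi> g)" and gX: "\<phi> g ` X = X"
        using action_homeomorphism(2)[OF act] action_image[OF act] g F by auto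
      have "compact (\<phi> g ` (U \<inter> cball z (3 * r)))"
        using that by (intro compact_continuous_image continuous_on_subset[OF cont] compact_Int_closed) auto
      moreover have "\<phi> g ` (U \<inter> cball z (3 * r)) \<subseteq> X" using that gX by blast
      moreover have "connected (\<phi> g ` D)"
        using D that by (intro connected_continuous_image continuous_on_subset[OF cont]) auto
      moreover have "\<phi> g ` D \<subseteq> \<phi> g ` (U \<inter> cball z (3 * r))" using D that by blast
      ultimately have "\<phi> g ` (U \<inter> cball z (3 * r)) \<in> wide X c"
        unfolding wide_def using D g by blast
      then show ?thesis using g by blast
    qed
    show "branching (piece \<phi>) I (wide X c)"
      unfolding branching_def
    proof
      fix U assume "U \<in> wide X c"
      then obtain C x y where U: "compact U" "U \<subseteq> X" "C \<subseteq> U" "connected C" "x \<in> C" "y \<in> C" "c \<le> dist x y"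
        unfolding wide_def by blast
      \<comment> \<open>Boundary bumping wants a compact connected set, so \<open>C\<close> is
        replaced by its closure.\<close>
      have cl: "closure C \<subseteq> U" using U by (simp add: closure_minimal compact_imp_closed)
      then have "compact (closure C)"
        using U by (metis closed_closure compact_Int_closed inf.absorb_iff2)
      note C = U(1,2) cl this connected_imp_connected_closure[OF U(4)]
      have xy: "x \<in> closure C" "y \<in> closure C" using U closure_subset by auto
      have "x \<in> (\<Union>z\<in>Z. ball z r)" "y \<in> (\<Union>z\<in>Z. ball z r)" using Z(2) U by blast+
      then obtain z z' where z: "z \<in> Z" "z' \<in> Z" "dist z x < r" "dist z' y < r"
        by auto
      obtain g h where gh: "g \<in> F" "h \<in> F" "\<phi> g ` (U \<inter> cball z (3 * r)) \<in> wide X c"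
        "\<phi> h ` (U \<inter> cball z' (3 * r)) \<in> wide X c"
        using big[OF C xy U(7) z(3)] big[OF C xy(2,1) _ z(4)] U(7) by (auto simp: dist_commute)
      have "disjnt (cball z (3 * r)) (cball z' (3 * r))"
      proof (rule ccontr)
        assume "\<not> disjnt (cball z (3 * r)) (cball z' (3 * r))"
        then obtain p where "dist z p \<le> 3 * r" "dist z' p \<le> 3 * r" by (auto simp: disjnt_def)
        moreover have "dist x y \<le> dist z x + dist z p + (dist z' p + dist z' y)"
          by metric
        ultimately show False using z U r by linarith
      qed
      then have "tup (z, z', g, h) \<in> I" using z gh unfolding I_def by blast
      moreover have "piece \<phi> (tup (z, z', g, h)) b U \<in> wide X c" for b
        using gh by (auto simp: piece_def tup_def)
      ultimately show "\<exists>t\<in>I. \<forall>b. piece \<phi> t b U \<in> wide X c" by blast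
    qed
  qed
qed

section \<open>Counting iterated pieces\<close>

text \<open>Expanded pieces may overlap, so they are pulled back to \<open>X\<close>:
  \<open>A w\<close> consists of the points with itinerary \<open>w\<close>, and
  \<open>\<gamma> w\<close> is the accumulated product, with one factor of length at most
  \<open>N\<close> per level.\<close>

lemma branching_iterated:
  fixes X :: "'a::metric_space set"
  assumes "group G" and S: "finite_generating_set G S" and act: "continuous_group_action G X \<phi>"
    and br: "branching (piece \<phi>) I \<L>" and XL: "X \<in> \<L>"
    and I: "\<And>t b. t \<in> I \<Longrightarrow> snd (t b) \<in> carrier G \<and> word_length G S (snd (t b)) \<le> N"
    and disj: "\<And>t. t \<in> I \<Longrightarrow> disjnt (fst (t True)) (fst (t False))"
  shows "\<exists>A \<gamma>. (\<forall>w :: bool list. length w = k \<longrightarrow> A w \<subseteq> X \<and> \<gamma> w \<in> carrier G \<and>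
      word_length G S (\<gamma> w) \<le> k * N \<and> \<phi> (\<gamma> w) ` A w \<in> \<L>) \<and>
    (\<forall>w w'. length w = k \<longrightarrow> length w' = k \<longrightarrow> w \<noteq> w' \<longrightarrow> disjnt (A w) (A w'))"
proof (induction k)
  case 0
  interpret group G by fact
  have "\<phi> \<one>\<^bsub>G\<^esub> ` X = X" using action_image[OF act] by simp
  then show ?case using XL
    by (intro exI[of _ "\<lambda>_. X"] exI[of _ "\<lambda>_. \<one>\<^bsub>G\<^esub>"]) (simp add: word_length_one)
next
  case (Suc k)
  interpret group G by fact
  from Suc obtain A \<gamma> where IH: "\<forall>w :: bool list. length w = k \<longrightarrow> A w \<subseteq> X \<and> \<gamma> w \<in> carrier G \<and>
      word_length G S (\<gamma> w) \<le> k * N \<and> \<phi> (\<gamma> w) ` A w \<in> \<L>"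
    and dA: "\<forall>w w'. length w = k \<longrightarrow> length w' = k \<longrightarrow> w \<noteq> w' \<longrightarrow> disjnt (A w) (A w')"
    by (elim exE conjE) (rule that)
  note IH = IH[rule_format] and dA = dA[rule_format]
  have "\<forall>w. \<exists>t. length w = k \<longrightarrow> t \<in> I \<and> (\<forall>b. piece \<phi> t b (\<phi> (\<gamma> w) ` A w) \<in> \<L>)"
    using IH br unfolding branching_def by blast
  then obtain t where t: "\<And>w. length w = k \<Longrightarrow> t w \<in> I \<and> (\<forall>b. piece \<phi> (t w) b (\<phi> (\<gamma> w) ` A w) \<in> \<L>)"
    by metis
  \<comment> \<open>The head of a list is the latest choice: of \<open>A (tl v)\<close>, those
    points remain whose current image lies in the closed set chosen for \<open>hd v\<close>.\<close>
  define B where "B v = {x \<in> A (tl v). \<phi> (\<gamma> (tl v)) x \<in> fst (t (tl v) (hd v))}" for v :: "bool list"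
  define \<delta> where "\<delta> v = snd (t (tl v) (hd v)) \<otimes>\<^bsub>G\<^esub> \<gamma> (tl v)" for v :: "bool list"
  show ?case
  proof (intro exI[of _ B] exI[of _ \<delta>] conjI allI impI)
    fix v :: "bool list" assume v: "length v = Suc k"
    then have w: "length (tl v) = k" by simp
    note ih = IH[OF w] and tw = t[OF w] and tI = I[of "t (tl v)" "hd v"]
    show "B v \<subseteq> X" using ih by (auto simp: B_def)
    show "\<delta> v \<in> carrier G" using ih tw tI by (simp add: \<delta>_def)
    have "word_length G S (\<delta> v) \<le> word_length G S (snd (t (tl v) (hd v))) + word_length G S (\<gamma> (tl v))"
      unfolding \<delta>_def using ih tw tI by (intro word_length_mult[OF S]) auto
    then show "word_length G S (\<delta> v) \<le> Suc k * N" using ih tw tI by simp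
    have "\<phi> (\<delta> v) ` B v = piece \<phi> (t (tl v)) (hd v) (\<phi> (\<gamma> (tl v)) ` A (tl v))"
    proof -
      have "\<phi> (\<delta> v) x = \<phi> (snd (t (tl v) (hd v))) (\<phi> (\<gamma> (tl v)) x)" if "x \<in> B v" for x
        unfolding \<delta>_def using ih tw tI that by (intro action_mult[OF act]) (auto simp: B_def)
      then have "\<phi> (\<delta> v) ` B v = \<phi> (snd (t (tl v) (hd v))) ` (\<phi> (\<gamma> (tl v)) ` B v)"
        by (simp add: image_image cong: image_cong)
      also have "\<phi> (\<gamma> (tl v)) ` B v = \<phi> (\<gamma> (tl v)) ` A (tl v) \<inter> fst (t (tl v) (hd v))"
        by (auto simp: B_def)
      finally show ?thesis by (simp add: piece_def)
    qed
    then show "\<phi> (\<delta> v) ` B v \<in> \<L>" using tw by simp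
  next
    fix v v' :: "bool list" assume v: "length v = Suc k" "length v' = Suc k" "v \<noteq> v'"
    then have w: "length (tl v) = k" "length (tl v') = k" by simp_all
    show "disjnt (B v) (B v')"
    proof (cases "tl v = tl v'")
      case False
      then show ?thesis using dA[OF w] by (auto simp: B_def disjnt_def)
    next
      case True
      \<comment> \<open>Siblings use the same index, whose two closed sets are disjoint.\<close>
      then have "hd v \<noteq> hd v'" using v by (cases v; cases v') auto
      then have "disjnt (fst (t (tl v) (hd v))) (fst (t (tl v) (hd v')))"
        using disj t[OF w(1)] by (cases "hd v"; cases "hd v'") (auto simp: disjnt_sym)
      then show ?thesis using True by (auto simp: B_def disjnt_def)
    qed
  qed
qed

text \<open>For suitable \<open>k\<close> the \<open>2 ^ k\<close> itineraries outnumber the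
  available group elements so much that \<open>n\<close> of them share one \<open>g\<close>. A
  single homeomorphism \<open>\<phi> g\<close> keeps their sets disjoint.\<close>

lemma many_disjoint_members:
  fixes X :: "'a::metric_space set"
  assumes G: "group G" and S: "finite_generating_set G S" and sub: "subexponential_growth G S"
    and act: "continuous_group_action G X \<phi>" and L: "outer_regular X \<L>"
    and br: "branching (piece \<phi>) I \<L>" and XL: "X \<in> \<L>" and "0 < N"
    and I: "\<And>t b. t \<in> I \<Longrightarrow> snd (t b) \<in> carrier G \<and> word_length G S (snd (t b)) \<le> N"
    and disj: "\<And>t. t \<in> I \<Longrightarrow> disjnt (fst (t True)) (fst (t False))"
  shows "\<exists>\<W>\<subseteq>\<L>. finite \<W> \<and> card \<W> = n \<and> pairwise disjnt \<W>"
proof -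
  obtain k where k: "n * growth G S (k * N) < 2 ^ k"
    using subexponential_growth_below_power_2[OF sub \<open>0 < N\<close>] by blast
  obtain A \<gamma> where A: "\<And>w :: bool list. length w = k \<Longrightarrow> A w \<subseteq> X \<and> \<gamma> w \<in> carrier G \<and>
      word_length G S (\<gamma> w) \<le> k * N \<and> \<phi> (\<gamma> w) ` A w \<in> \<L>"
    and dA: "\<And>w w'. length w = k \<Longrightarrow> length w' = k \<Longrightarrow> w \<noteq> w' \<Longrightarrow> disjnt (A w) (A w')"
    using branching_iterated[OF G S act br XL, of N k] I disj by metis
  define B where "B = {h \<in> carrier G. word_length G S h \<le> k * N}"
  define \<Omega> where "\<Omega> = {w :: bool list. length w = k}"
  have B: "finite B" "card B = growth G S (k * N)"
    using group.finite_word_ball[OF G S] by (simp_all add: B_def growth_def)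
  have \<Omega>: "finite \<Omega>" "card \<Omega> = 2 ^ k"
    using card_lists_length_eq[of "UNIV :: bool set" k] finite_lists_length_eq[of "UNIV :: bool set" k]
    by (simp_all add: \<Omega>_def)
  have "\<Omega> = (\<Union>g\<in>B. {w \<in> \<Omega>. \<gamma> w = g})" using A by (auto simp: \<Omega>_def B_def)
  then have "2 ^ k \<le> (\<Sum>g\<in>B. card {w \<in> \<Omega>. \<gamma> w = g})"
    using card_UN_le[OF B(1), of "\<lambda>g. {w \<in> \<Omega>. \<gamma> w = g}"] \<Omega>(2) by simp
  \<comment> \<open>At most \<open>n\<close> itineraries for each element would give a total below
    \<open>2 ^ k\<close>.\<close>
  then have "\<not> (\<forall>g\<in>B. card {w \<in> \<Omega>. \<gamma> w = g} \<le> n)"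
    using sum_bounded_above[of B "\<lambda>g. card {w \<in> \<Omega>. \<gamma> w = g}" n] k B(2)
    by (auto simp: mult.commute)
  then obtain g where g: "g \<in> carrier G" "n \<le> card {w \<in> \<Omega>. \<gamma> w = g}" by (auto simp: B_def)
  then obtain \<Psi> where \<Psi>: "\<Psi> \<subseteq> {w \<in> \<Omega>. \<gamma> w = g}" "card \<Psi> = n" "finite \<Psi>"
    by (meson obtain_subset_with_card_n)
  have mem: "\<phi> g ` A w \<in> \<L>" "A w \<subseteq> X" "length w = k" if "w \<in> \<Psi>" for w
    using A[of w] \<Psi>(1) that by (auto simp: \<Omega>_def)
  have dis: "disjnt (\<phi> g ` A w) (\<phi> g ` A w')" if "w \<in> \<Psi>" "w' \<in> \<Psi>" "w \<noteq> w'" for w w'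
    using that mem dA by (intro disjnt_action_image[OF act g(1)]) auto
  have "inj_on (\<lambda>w. \<phi> g ` A w) \<Psi>"
  proof (rule inj_onI, rule ccontr)
    fix w w' assume "w \<in> \<Psi>" "w' \<in> \<Psi>" "\<phi> g ` A w = \<phi> g ` A w'" "w \<noteq> w'"
    then show False using dis[of w w'] outer_regularD(3)[OF L mem(1)[of w]] by (simp add: disjnt_def)
  qed
  then have "card ((\<lambda>w. \<phi> g ` A w) ` \<Psi>) = n" using \<Psi> by (simp add: card_image)
  moreover have "pairwise disjnt ((\<lambda>w. \<phi> g ` A w) ` \<Psi>)" using dis by (auto simp: pairwise_def)
  moreover have "(\<lambda>w. \<phi> g ` A w) ` \<Psi> \<subseteq> \<L>" using mem by auto
  ultimately show ?thesis using \<Psi>(3) by (intro exI[of _ "(\<lambda>w. \<phi> g ` A w) ` \<Psi>"]) auto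
qed

section \<open>Contradiction with the Suslinian property\<close>

text \<open>A family inside its own derivative is perfect, so a Cantor scheme gives uncountably many
  disjoint members, and each contains a nondegenerate subcontinuum.\<close>

lemma self_derived_not_suslinian:
  fixes X :: "'a::metric_space set"
  assumes X: "compact X" and L: "outer_regular X \<L>" "\<L> \<subseteq> wide X c" "X \<in> \<L>" and "0 < c"
    and perf: "\<L> \<subseteq> derived_family X \<L>"
  shows "\<not> suslinian_continuum X"
proof -
  obtain E :: "(nat \<Rightarrow> bool) \<Rightarrow> 'a set" where E: "\<And>\<sigma>. E \<sigma> \<in> \<L>" "\<And>\<sigma> \<tau>. \<sigma> \<noteq> \<tau> \<Longrightarrow> disjnt (E \<sigma>) (E \<tau>)"
    using perfect_family_Cantor_scheme[OF X L(1) perf L(3)] by blast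
  have "\<forall>\<sigma>. \<exists>C\<subseteq>E \<sigma>. subcontinuum C X \<and> nondegenerate C"
    using wide_nondegenerate_continuum[OF _ \<open>0 < c\<close>] E(1) L(2) by blast
  then obtain C where C: "\<And>\<sigma>. C \<sigma> \<subseteq> E \<sigma>" "\<And>\<sigma>. subcontinuum (C \<sigma>) X" "\<And>\<sigma>. nondegenerate (C \<sigma>)"
    by metis
  have dis: "disjnt (C \<sigma>) (C \<tau>)" if "\<sigma> \<noteq> \<tau>" for \<sigma> \<tau>
    using E(2)[OF that] C(1)[of \<sigma>] C(1)[of \<tau>] unfolding disjnt_def by blast
  have ne: "C \<sigma> \<noteq> {}" for \<sigma> using C(2)[of \<sigma>] by (simp add: subcontinuum_def continuum_def)
  have "inj C"
  proof (rule injI, rule ccontr)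
    fix \<sigma> \<tau> assume "C \<sigma> = C \<tau>" "\<sigma> \<noteq> \<tau>"
    then show False using dis[of \<sigma> \<tau>] ne[of \<tau>] by (simp add: disjnt_def)
  qed
  then have "uncountable (range C)"
    using uncountable_binary_sequences countable_image_inj_on by blast
  moreover have "pairwise disjnt (range C)" by (rule pairwiseI) (metis dis imageE)
  ultimately have "\<exists>\<C>. uncountable \<C> \<and> pairwise disjnt \<C> \<and> (\<forall>C\<in>\<C>. subcontinuum C X \<and> nondegenerate C)"
    using C by (intro exI[of _ "range C"]) auto
  then show ?thesis by (simp add: suslinian_continuum_def)
qed

theorem theorem1p3:
  fixes G :: "('g, 'm) monoid_scheme"
    and S :: "'g set"
    and X :: "'a::metric_space set"
  assumes "group G"
    and "finite_generating_set G S"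
    and "subexponential_growth G S"
    and "suslinian_continuum X"
    and "nondegenerate X"
  shows "\<not> (\<exists>\<phi>. continuous_group_action G X \<phi> \<and> expansive G X \<phi>)"
proof
  assume "\<exists>\<phi>. continuous_group_action G X \<phi> \<and> expansive G X \<phi>"
  then obtain \<phi> c where act: "continuous_group_action G X \<phi>" and "0 < c"
    and exp: "\<And>x y. x \<in> X \<Longrightarrow> y \<in> X \<Longrightarrow> x \<noteq> y \<Longrightarrow> c < (SUP g\<in>carrier G. dist (\<phi> g x) (\<phi> g y))"
    unfolding expansive_def by blast
  have X: "compact X" "connected X" "X \<noteq> {}"
    using assms(4) by (auto simp: suslinian_continuum_def continuum_def)
  obtain F where F: "finite F" "F \<subseteq> carrier G"
    "\<And>x y. x \<in> X \<Longrightarrow> y \<in> X \<Longrightarrow> c / 4 \<le> dist x y \<Longrightarrow> \<exists>g\<in>F. c \<le> dist (\<phi> g x) (\<phi> g y)"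
    using expansive_uniform[OF act assms(1) X(1) exp, of "c / 4"] \<open>0 < c\<close> by auto
  obtain I where I: "finite I" "\<forall>t\<in>I. \<forall>b. closed (fst (t b)) \<and> snd (t b) \<in> F"
    "\<forall>t\<in>I. disjnt (fst (t True)) (fst (t False))" "branching (piece \<phi>) I (wide X c)"
    by (rule branching_wide[OF act X(1) \<open>0 < c\<close> F])
  \<comment> \<open>Expansiveness pushes two distinct points of the connected set \<open>X\<close>
    more than \<open>c\<close> apart.\<close>
  have XW: "X \<in> wide X c"
  proof -
    obtain x y where xy: "x \<in> X" "y \<in> X" "x \<noteq> y"
      using X(3) assms(5) unfolding nondegenerate_def by blast
    then obtain g where g: "g \<in> carrier G" "c < dist (\<phi> g x) (\<phi> g y)"
      using expansive_at_pair[OF act assms(1) X(1)] exp by blast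
    then have "\<phi> g x \<in> X" "\<phi> g y \<in> X" using xy action_image[OF act] by blast+
    moreover have "c \<le> dist (\<phi> g x) (\<phi> g y)" using g by simp
    ultimately show ?thesis using X(1,2) unfolding wide_def by blast
  qed
  obtain \<L> where L: "outer_regular X \<L>" "branching (piece \<phi>) I \<L>" "X \<in> \<L>" "\<L> \<subseteq> wide X c"
    and min: "\<forall>\<K>. outer_regular X \<K> \<longrightarrow> branching (piece \<phi>) I \<K> \<longrightarrow> X \<in> \<K> \<longrightarrow> \<K> \<subseteq> \<L> \<longrightarrow> \<K> = \<L>"
    by (rule minimal_branching_family[OF outer_regular_wide[OF X(1)] I(4) XW I(1)])
  have Ic: "closed (fst (t b))" "snd (t b) \<in> carrier G" if "t \<in> I" for t b
    using I(2) that F(2) by auto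
  have "branching (piece \<phi>) I (derived_family X \<L>)"
  proof (rule branching_derived_family[OF L(1,2) I(1)])
    show "disjnt (piece \<phi> t b A) (piece \<phi> t b B)"
      if "t \<in> I" "A \<subseteq> X" "B \<subseteq> X" "disjnt A B" for t b A B
      unfolding piece_def using that Ic
      by (intro disjnt_action_image[OF act]) (auto simp: disjnt_def)
    show "compact (piece \<phi> t b U) \<and> piece \<phi> t b U \<subseteq> X" if "t \<in> I" "compact U" "U \<subseteq> X" for t b U
      using that Ic by (intro compact_piece[OF act])
    show "\<exists>V'. open V' \<and> U \<subseteq> V' \<and> (\<forall>W\<subseteq>X. W \<subseteq> V' \<longrightarrow> piece \<phi> t b W \<subseteq> V)"
      if "t \<in> I" "compact U" "U \<subseteq> X" "open V" "piece \<phi> t b U \<subseteq> V" for t b U V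
      using that Ic X(1) by (intro piece_neighbourhood[OF act])
  qed
  \<comment> \<open>The derivative inherits every property but membership of \<open>X\<close>, so by
    minimality that membership is all that remains to be shown.\<close>
  then have der: "X \<in> derived_family X \<L> \<Longrightarrow> derived_family X \<L> = \<L>"
    using min outer_regular_derived_family[OF L(1)] derived_family_subset[OF L(1)] by blast
  \<comment> \<open>\<open>insert 0\<close> gives \<open>Max\<close> a value when \<open>F\<close>
    is empty, and \<open>Suc\<close> makes \<open>N\<close> positive, as an \<open>N\<close>-th root
    requires.\<close>
  define N where "N = Suc (Max (insert 0 (word_length G S ` F)))"
  have N: "snd (t b) \<in> carrier G \<and> word_length G S (snd (t b)) \<le> N" if "t \<in> I" for t b
  proof -
    have "word_length G S (snd (t b)) \<le> Max (insert 0 (word_length G S ` F))"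
      using I(2) that F(1) by (intro Max_ge) auto
    then show ?thesis using Ic[OF that] by (simp add: N_def)
  qed
  \<comment> \<open>A neighbourhood of \<open>X\<close> contains every member of \<L>, so only the
    number of disjoint members matters; the growth count supplies it.\<close>
  have "X \<in> derived_family X \<L>"
    unfolding derived_family_def mem_Collect_eq
  proof (intro conjI allI impI)
    fix V and n :: nat assume "X \<subseteq> V"
    obtain \<W> where W: "\<W> \<subseteq> \<L>" "finite \<W>" "card \<W> = n" "pairwise disjnt \<W>"
      using many_disjoint_members[OF assms(1-3) act L(1-3), of N n] N I(3) by (auto simp: N_def)
    moreover have "\<Union>\<W> \<subseteq> V" using W(1) outer_regularD(2)[OF L(1)] \<open>X \<subseteq> V\<close> by blast
    ultimately show "\<exists>\<W>\<subseteq>\<L>. finite \<W> \<and> card \<W> = n \<and> pairwise disjnt \<W> \<and> \<Union>\<W> \<subseteq> V"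
      by blast
  qed (use X in auto)
  then show False
    using self_derived_not_suslinian[OF X(1) L(1,4,3) \<open>0 < c\<close>] der assms(4) by blast
qed

end
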